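(* Let $V$ be a vector space with a linear map $Y(\cdot,x):V\to(\mathrm{End}\,V)[[x,x^{-1}]]$, $v\mapsto Y(v,x)=\sum_{n\in\mathbb Z}v_nx^{-n-1}$, and a vector $\mathbf 1\in V$, satisfying the minor axioms of a vertex algebra: $Y(\cdot,x)$ is injective; $Y(u,x)v\in V((x))$ for all $u,v\in V$; $Y(\mathbf 1,x)=1$; and for all $u\in V$, $Y(u,x)\mathbf 1\in V[[x]]$ and $Y(u,0)\mathbf 1=u$. Define $\mathcal D\in\mathrm{End}(V)$ by $\mathcal Dv=v_{-2}\mathbf 1$. Then the following are equivalent: (1) (Jacobi identity) for all $u,v\in V$, $$x_0^{-1}\delta\left(\frac{x_1-x_2}{x_0}\right)Y(u,x_1)Y(v,x_2)-x_0^{-1}\delta\left(\frac{-x_2+x_1}{x_0}\right)Y(v,x_2)Y(u,x_1)=x_1^{-1}\delta\left(\frac{x_2+x_0}{x_1}\right)Y(Y(u,x_0)v,x_2);$$ (2) weak skew-associativity and skew-symmetry both hold; (3) weak skew-associativity and the $\mathcal D$-bracket derivative property both hold. Here weak skew-associativity means: for all $u,v,w\in V$ there exists an integer $m\ge0$ such that $(x_1-x_0)^{m}\left(Y(v,-x_0+x_1)Y(u,x_1)w-Y(Y(u,x_0)v,x_1-x_0)w\right)=0$; skew-symmetry means: $Y(u,x)v=e^{x\mathcal D}Y(v,-x)u$ for all $u,v\in V$; and the $\mathcal D$-bracket derivative property means: $[\mathcal D,Y(u,x)]=\frac{d}{dx}Y(u,x)$ for all $u\in V$.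
   Context: All vector spaces are over $\mathbb C$; formal variables commute. For a vector space $U$, $U[[x,x^{-1}]]$ is the space of all formal Laurent series $\sum_{n\in\mathbb Z}u_nx^n$ with $u_n\in U$; $U((x))$ is the subspace of series with $u_n=0$ for $n$ sufficiently negative; $U[[x]]$ is the space of formal power series. $\delta(x)=\sum_{n\in\mathbb Z}x^n$. Binomial expansion convention: for every $n\in\mathbb Z$, $(x+y)^n=\sum_{k\ge0}\binom nk x^{n-k}y^k$, i.e. binomials are expanded in nonnegative powers of the second-listed variable (likewise with signs, so $(x_1-x_2)^n$ is expanded in nonnegative powers of $x_2$ and $(-x_2+x_1)^n$ in nonnegative powers of $x_1$); this applies inside $\delta$ and to substitutions such as $F(x+y)$. The map $Y$ is extended coefficientwise to series: $Y(Y(u,x_0)v,x_2)=\sum_n Y(u_nv,x_2)x_0^{-n-1}$. $e^{x\mathcal D}=\sum_{n\ge0}\frac{x^n}{n!}\mathcal D^n$. *)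

theory Defs
  imports Complex_Main "HOL-Library.Groups_Big_Fun" "HOL-Library.Product_Plus"
begin

text \<open>
  A formal series, possibly unbounded in both directions, is its coefficient function on
  exponents: \<open>int\<close> for one variable, \<open>int \<times> int\<close> for \<open>(x\<^sub>0, x\<^sub>1)\<close>, and
  \<open>int \<times> int \<times> int\<close> for \<open>(x\<^sub>0, x\<^sub>1, x\<^sub>2)\<close>. An operator-valued series has
  coefficients \<open>'v \<Rightarrow> 'v\<close>, and a product of such series is evaluated on a fixed vector.
\<close>

text \<open>
  Convolution of an operator-valued with a vector-valued series. Only the products in which
  every coefficient is a finite sum are meaningful (\<open>Sum_any\<close> is \<open>0\<close> on infinite supports);
  for all products below this follows from lower truncation of \<open>Y u\<close>. Multiplication by
  a scalar series \<open>c\<close> is \<open>(scale \<circ> c) \<odot> B\<close>.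
\<close>

definition fs_mult ::
  "('e::ab_group_add \<Rightarrow> 'a \<Rightarrow> 'b::comm_monoid_add) \<Rightarrow> ('e \<Rightarrow> 'a) \<Rightarrow> 'e \<Rightarrow> 'b"  (infixr "\<odot>" 70)
  where "(A \<odot> B) e = Sum_any (\<lambda>d. A d (B (e - d)))"

text \<open>
  The coefficient of \<open>x\<^sup>i y\<^sup>j\<close> in \<open>(\<sigma> x + \<tau> y)\<^sup>n\<close>, expanded in nonnegative powers of \<open>y\<close>.
\<close>

definition binomial_series :: "complex \<Rightarrow> complex \<Rightarrow> int \<Rightarrow> int \<Rightarrow> int \<Rightarrow> complex"
  where "binomial_series \<sigma> \<tau> n i j =
    (if 0 \<le> j \<and> i + j = n then (of_int n gchoose nat j) * \<sigma> powi i * \<tau> powi j else 0)"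

definition delta :: "int \<Rightarrow> complex"
  where "delta n = 1"

text \<open>
  The coefficient of \<open>z\<^sup>h x\<^sup>i y\<^sup>j\<close> in \<open>z\<^sup>-\<^sup>1 \<delta>((\<sigma> x + \<tau> y) / z)\<close>, that is, in the sum over
  all integers \<open>n\<close> of \<open>\<delta>\<^sub>n z\<^sup>-\<^sup>n\<^sup>-\<^sup>1 (\<sigma> x + \<tau> y)\<^sup>n\<close>; only \<open>n = - h - 1\<close> contributes.
\<close>

definition delta_quot :: "complex \<Rightarrow> complex \<Rightarrow> int \<Rightarrow> int \<Rightarrow> int \<Rightarrow> complex"
  where "delta_quot \<sigma> \<tau> h i j = delta (- h - 1) * binomial_series \<sigma> \<tau> (- h - 1) i j"

text \<open>
  The coefficient of \<open>x\<^sup>i y\<^sup>j\<close> in \<open>F(\<sigma> x + \<tau> y)\<close>; only the term \<open>n = i + j\<close> of \<open>F\<close>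
  contributes.
\<close>

definition subst_binomial ::
  "(complex \<Rightarrow> 'v \<Rightarrow> 'v) \<Rightarrow> complex \<Rightarrow> complex \<Rightarrow> (int \<Rightarrow> 'v) \<Rightarrow> int \<Rightarrow> int \<Rightarrow> 'v"
  where "subst_binomial scale \<sigma> \<tau> F i j = scale (binomial_series \<sigma> \<tau> (i + j) i j) (F (i + j))"

definition fs_deriv :: "(complex \<Rightarrow> 'v \<Rightarrow> 'v) \<Rightarrow> (int \<Rightarrow> 'v) \<Rightarrow> int \<Rightarrow> 'v"
  where "fs_deriv scale F n = scale (of_int (n + 1)) (F (n + 1))"

text \<open>
  \<open>Y u n\<close> is the coefficient of \<open>x\<^sup>n\<close> in \<open>Y(u,x)\<close>; the conventional modes, for which
  \<open>Y(u,x)\<close> is the sum of all \<open>u\<^sub>n x\<^sup>-\<^sup>n\<^sup>-\<^sup>1\<close>, are given by \<open>vmode\<close>.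
\<close>

definition vmode :: "('v \<Rightarrow> int \<Rightarrow> 'v \<Rightarrow> 'v) \<Rightarrow> 'v \<Rightarrow> int \<Rightarrow> 'v \<Rightarrow> 'v"
  where "vmode Y u n = Y u (- n - 1)"

definition vderiv :: "('v \<Rightarrow> int \<Rightarrow> 'v \<Rightarrow> 'v) \<Rightarrow> 'v \<Rightarrow> 'v \<Rightarrow> 'v"
  where "vderiv Y vac v = vmode Y v (-2) vac"

locale minor_vertex_axioms = vector_space scale
  for scale :: "complex \<Rightarrow> 'v::ab_group_add \<Rightarrow> 'v" +
  fixes Y :: "'v \<Rightarrow> int \<Rightarrow> 'v \<Rightarrow> 'v" and vac :: 'v
  assumes Y_endo: "Vector_Spaces.linear scale scale (Y u n)"
    and Y_linear: "Vector_Spaces.linear scale scale (\<lambda>u. Y u n w)"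
    and Y_inj: "inj Y"
    and Y_truncation: "\<exists>N. \<forall>n<N. Y u n v = 0"
    and Y_vac: "Y vac n = (if n = 0 then id else (\<lambda>_. 0))"
    and Y_creation: "n < 0 \<Longrightarrow> Y u n vac = 0"
    and Y_creation_0: "Y u 0 vac = u"

definition jacobi_identity ::
  "(complex \<Rightarrow> 'v::ab_group_add \<Rightarrow> 'v) \<Rightarrow> ('v \<Rightarrow> int \<Rightarrow> 'v \<Rightarrow> 'v) \<Rightarrow> bool"
  where "jacobi_identity scale Y \<longleftrightarrow> (\<forall>u v w. \<forall>e :: int \<times> int \<times> int.
      ((scale \<circ> (\<lambda>(a, b, c). delta_quot 1 (-1) a b c))
        \<odot> (\<lambda>(a, b, c). if a = 0 then Y u b (Y v c w) else 0)) e
      - ((scale \<circ> (\<lambda>(a, b, c). delta_quot (-1) 1 a c b))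
        \<odot> (\<lambda>(a, b, c). if a = 0 then Y v c (Y u b w) else 0)) e
      = ((scale \<circ> (\<lambda>(a, b, c). delta_quot 1 1 b c a))
        \<odot> (\<lambda>(a, b, c). if b = 0 then Y (Y u a v) c w else 0)) e)"

text \<open>
  The two series in \<open>(x\<^sub>0, x\<^sub>1)\<close> compared below are \<open>Y(v, -x\<^sub>0 + x\<^sub>1) Y(u, x\<^sub>1) w\<close> and
  \<open>Y(Y(u, x\<^sub>0) v, x\<^sub>1 - x\<^sub>0) w\<close>; the latter is the linear-map-valued series
  \<open>z \<mapsto> Y(z, x\<^sub>1 - x\<^sub>0) w\<close> convolved with \<open>Y(u, x\<^sub>0) v\<close>.
\<close>

definition weak_skew_associativity ::
  "(complex \<Rightarrow> 'v::ab_group_add \<Rightarrow> 'v) \<Rightarrow> ('v \<Rightarrow> int \<Rightarrow> 'v \<Rightarrow> 'v) \<Rightarrow> bool"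
  where "weak_skew_associativity scale Y \<longleftrightarrow> (\<forall>u v w. \<exists>m::nat. \<forall>e :: int \<times> int.
      ((scale \<circ> (\<lambda>(a, b). binomial_series 1 (-1) (int m) b a))
        \<odot> (\<lambda>e'.
            ((\<lambda>(a, b) z. subst_binomial scale (-1) 1 (\<lambda>n. Y v n z) a b)
              \<odot> (\<lambda>(a, b). if a = 0 then Y u b w else 0)) e'
          - ((\<lambda>(a, b) z. subst_binomial scale 1 (-1) (\<lambda>n. Y z n w) b a)
              \<odot> (\<lambda>(a, b). if b = 0 then Y u a v else 0)) e')) e = 0)"

definition exp_series ::
  "(complex \<Rightarrow> 'v::ab_group_add \<Rightarrow> 'v) \<Rightarrow> ('v \<Rightarrow> 'v) \<Rightarrow> int \<Rightarrow> 'v \<Rightarrow> 'v"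
  where "exp_series scale D n v =
    (if 0 \<le> n then scale (1 / fact (nat n)) ((D ^^ nat n) v) else 0)"

definition skew_symmetry ::
  "(complex \<Rightarrow> 'v::ab_group_add \<Rightarrow> 'v) \<Rightarrow> ('v \<Rightarrow> int \<Rightarrow> 'v \<Rightarrow> 'v) \<Rightarrow> 'v \<Rightarrow> bool"
  where "skew_symmetry scale Y vac \<longleftrightarrow> (\<forall>u v. \<forall>n :: int.
      Y u n v = (exp_series scale (vderiv Y vac) \<odot> (\<lambda>k. scale ((-1) powi k) (Y v k u))) n)"

definition D_bracket_derivative ::
  "(complex \<Rightarrow> 'v::ab_group_add \<Rightarrow> 'v) \<Rightarrow> ('v \<Rightarrow> int \<Rightarrow> 'v \<Rightarrow> 'v) \<Rightarrow> 'v \<Rightarrow> bool"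
  where "D_bracket_derivative scale Y vac \<longleftrightarrow> (\<forall>u w. \<forall>n :: int.
      vderiv Y vac (Y u n w) - Y u n (vderiv Y vac w) = fs_deriv scale (\<lambda>k. Y u k w) n)"

end

theory Submission
  imports Defs
begin

text \<open>
  For vectors \<open>u, v, w\<close> let \<open>J(u,v,w)\<close> be the difference of the two sides of the Jacobi identity,
  applied to \<open>w\<close>; it is a series in \<open>x\<^sub>0, x\<^sub>1, x\<^sub>2\<close>. Each of the three delta functions is
  annihilated by \<open>x\<^sub>0 - x\<^sub>1 + x\<^sub>2\<close>, so the coefficients of \<open>J(u,v,w)\<close> satisfy a three-term
  recurrence (\<open>jacobi_defect_recurrence\<close>), along which zeros spread: a series with this
  property is zero as soon as its coefficients vanish for all low exponents of one variable and
  for all low exponents of a second one (\<open>quadrant_induct\<close>).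

  Taking the residue in \<open>x\<^sub>2\<close> after multiplication by a high power of \<open>x\<^sub>2\<close> shows that weak
  skew-associativity says precisely that \<open>J(u,v,w)\<close> vanishes for all low exponents of \<open>x\<^sub>2\<close>
  (\<open>weak_skew_associativity_iff_truncated\<close>). So the Jacobi identity implies it, and all three
  conditions of the theorem turn out to be equivalent to weak skew-associativity.

  The second direction of vanishing comes from the vacuum. The coefficients of \<open>J(u,\<one>,w)\<close>
  vanish where the exponents of \<open>x\<^sub>0\<close> and \<open>x\<^sub>2\<close> are both negative, those of \<open>J(u,v,\<one>)\<close> where
  the exponents of \<open>x\<^sub>1\<close> and \<open>x\<^sub>2\<close> are. Given weak skew-associativity, both series therefore
  vanish for every negative exponent of \<open>x\<^sub>2\<close>. One coefficient of \<open>J(u,\<one>,w)\<close> then says that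
  \<open>Y(\<D>u,x)\<close> is the derivative of \<open>Y(u,x)\<close>, whence \<open>Y(u,x)\<one> = e\<^sup>x\<^sup>\<D>u\<close>; one family of
  coefficients of \<open>J(v,u,\<one>)\<close> says that \<open>Y(u,x)v = Y(Y(v,-x)u,x)\<one>\<close>, both occurrences of
  \<open>x\<close> being the same variable. The two combine to skew-symmetry.

  The left-hand side of the Jacobi identity is invariant under the exchange of \<open>(u,x\<^sub>1)\<close> with
  \<open>(v,x\<^sub>2)\<close> together with \<open>x\<^sub>0 \<mapsto> -x\<^sub>0\<close>, and skew-symmetry makes the right-hand side
  invariant as well (\<open>jacobi_defect_swap\<close>). Hence \<open>J(u,v,w)\<close> vanishes for
  all low exponents of \<open>x\<^sub>1\<close> as well as of \<open>x\<^sub>2\<close>, and so \<open>J(u,v,w) = 0\<close>. Finally the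
  \<open>\<D>\<close>-bracket derivative property is one family of coefficients of \<open>J(u,v,\<one>) = 0\<close>.
\<close>

section \<open>Preliminaries on sums, signs and integer induction\<close>

lemma Sum_any_inj_reindex:
  assumes "inj h" and "\<And>d. d \<notin> range h \<Longrightarrow> g d = 0"
  shows "Sum_any g = Sum_any (\<lambda>i. g (h i))"
proof -
  have supp: "{d. g d \<noteq> 0} = h ` {i. g (h i) \<noteq> 0}"
    using assms(2) by (auto simp: image_iff) (metis rangeE)
  have "inj_on h {i. g (h i) \<noteq> 0}"
    using assms(1) by (auto simp: inj_on_def inj_def)
  then show ?thesis
    unfolding Sum_any.expand_set supp by (simp add: sum.reindex)
qed

lemma Sum_any_eq_sum_lessThan:
  fixes n :: nat
  assumes "\<And>i. n \<le> i \<Longrightarrow> g i = 0"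
  shows "Sum_any g = (\<Sum>i<n. g i)"
  using assms by (intro Sum_any.expand_superset) (auto simp: not_less[symmetric])

lemma Sum_any_single_0:
  fixes g :: "nat \<Rightarrow> 'a::comm_monoid_add"
  assumes "\<And>i. 0 < i \<Longrightarrow> g i = 0"
  shows "Sum_any g = g 0"
  using Sum_any_eq_sum_lessThan[of 1 g] assms by simp

lemma minus_one_powi_simps:
  "(-1::complex) powi (a - 1) = - ((-1) powi a)"
  "(-1::complex) powi (- a) = (-1) powi a"
  "(-1::complex) powi a * (-1) powi a = 1"
  "(-1::complex) powi (int i) = (-1) ^ i"
     apply (simp add: power_int_diff)
    apply (cases "even a"; simp add: power_int_minus_left)
   apply (cases "even a"; simp add: power_int_minus_left)
  apply simp
  done

lemma gbinomial_minus_one: "((-1::complex) gchoose i) = (-1) ^ i"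
  by (subst gbinomial_negated_upper) (simp add: binomial_gbinomial[symmetric])

text \<open>
  Every step goes down in one of the two coordinates, so the recursion ends in the half-plane
  below \<open>C\<close> or to the left of \<open>A\<close>. The bound \<open>K\<close> is there because for the vacuum the vanishing
  on the left is known only for negative \<open>y\<close>.
\<close>

lemma quadrant_induct:
  fixes V :: "int \<Rightarrow> int \<Rightarrow> bool"
  assumes step: "\<And>x y. V (x - 1) y \<Longrightarrow> V x (y - 1) \<Longrightarrow> V x y"
    and below: "\<And>x y. y < C \<Longrightarrow> V x y"
    and left: "\<And>x y. x < A \<Longrightarrow> y < K \<Longrightarrow> V x y"
    and "y < K"
  shows "V x y"
  using \<open>y < K\<close>
proof (induction "nat (x - A + 1) + nat (y - C + 1)" arbitrary: x y rule: less_induct)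
  case less
  consider "y < C" | "x < A" | "C \<le> y" "A \<le> x" by linarith
  then show ?case
  proof cases
    case 1
    then show ?thesis by (rule below)
  next
    case 2
    then show ?thesis using less.prems by (rule left)
  next
    case 3
    show ?thesis
    proof (rule step)
      show "V (x - 1) y" using 3 less.prems by (intro less.hyps) simp_all
      show "V x (y - 1)" using 3 less.prems by (intro less.hyps) simp_all
    qed
  qed
qed

lemma int_shift_invariant:
  fixes g :: "int \<Rightarrow> int \<Rightarrow> 'a"
  assumes "\<And>b c. g (b - 1) c = g b (c - 1)"
  shows "g b c = g k (b + c - k)"
proof -
  have "g t (b + c - t) = g k (b + c - k)" for t
  proof (induction t rule: int_induct[where k = k])
    case (step1 i)
    then show ?case using assms[of "i + 1" "b + c - i"] by (simp add: algebra_simps)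
  next
    case (step2 i)
    then show ?case using assms[of i "b + c - (i - 1)"] by (simp add: algebra_simps)
  qed simp
  from this[of b] show ?thesis by simp
qed

section \<open>Linearity and binomial sums\<close>

context minor_vertex_axioms
begin

lemma Y_add_right: "Y u n (v + w) = Y u n v + Y u n w"
  and Y_scale_right: "Y u n (scale c v) = scale c (Y u n v)"
  and Y_add_left: "Y (u + v) n w = Y u n w + Y v n w"
  and Y_scale_left: "Y (scale c u) n w = scale c (Y u n w)"
  using Y_endo Y_linear unfolding Vector_Spaces.linear_iff by auto

lemma Y_zero_right [simp]: "Y u n 0 = 0"
  and Y_zero_left [simp]: "Y 0 n w = 0"
  using Y_scale_right[of u n 0 0] Y_scale_left[of 0 0 n w] by simp_all

lemma Y_sum_left: "Y (sum g A) n w = (\<Sum>i\<in>A. Y (g i) n w)"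
  by (induction A rule: infinite_finite_induct) (auto simp: Y_add_left)

lemma Y_Sum_any_left:
  assumes "\<And>i::nat. k \<le> i \<Longrightarrow> g i = 0"
  shows "Y (Sum_any g) n w = Sum_any (\<lambda>i. Y (g i) n w)"
  using assms by (simp add: Sum_any_eq_sum_lessThan[of k] Y_sum_left)

lemma scale_Sum_any: "scale c (Sum_any g) = Sum_any (\<lambda>i. scale c (g i))"
proof (cases "c = 0")
  case False
  then show ?thesis by (simp add: Sum_any.expand_set scale_sum_right)
qed simp

text \<open>
  If \<open>f p q\<close> is the coefficient of \<open>x\<^sup>p y\<^sup>q\<close> in a series, this is the coefficient of
  \<open>x\<^sup>p\<^sup>+\<^sup>l y\<^sup>q\<close> in its product with \<open>(x + s y)\<^sup>l\<close>. All terms of the Jacobi identity and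
  of weak skew-associativity are sums of this one shape.
\<close>

definition binomial_sum :: "complex \<Rightarrow> (int \<Rightarrow> int \<Rightarrow> 'v) \<Rightarrow> int \<Rightarrow> int \<Rightarrow> int \<Rightarrow> 'v"
  where "binomial_sum s f l p q =
    Sum_any (\<lambda>i::nat. scale (s ^ i * (of_int l gchoose i)) (f (p + int i) (q - int i)))"

lemma binomial_sum_0 [simp]: "binomial_sum s f 0 p q = f p q"
  unfolding binomial_sum_def
  by (subst Sum_any_single_0) (auto simp: gbinomial_0_left)

lemma binomial_sum_eq_0_lower:
  assumes "\<And>p' q'. q' \<le> q \<Longrightarrow> f p' q' = 0"
  shows "binomial_sum s f l p q = 0"
  using assms by (simp add: binomial_sum_def)

text \<open>For \<open>l \<ge> 0\<close> the binomial coefficients cut the sum off after the index \<open>l\<close>.\<close>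

lemma binomial_sum_eq_0_upper:
  assumes "0 \<le> l" and "\<And>p' q'. p' \<le> p + l \<Longrightarrow> f p' q' = 0"
  shows "binomial_sum s f l p q = 0"
proof -
  have "(of_int l gchoose i :: complex) = 0" if "l < int i" for i
    using assms(1) that by (cases l) (auto simp: binomial_gbinomial[symmetric])
  then have "scale (s ^ i * (of_int l gchoose i)) (f (p + int i) (q - int i)) = 0" for i
    using assms(2)[of "p + int i"] by (cases "int i \<le> l") auto
  then show ?thesis unfolding binomial_sum_def by (simp only: Sum_any.neutral)
qed

text \<open>
  This is \<open>(x + s y)\<^sup>l\<^sup>+\<^sup>1 = (x + s y)\<^sup>l (x + s y)\<close>. Finite support, which is required for
  splitting the sums, has two different sources: truncation of \<open>f\<close>, or \<open>l \<ge> 0\<close>; the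
  hypotheses cover both.
\<close>

lemma binomial_sum_Pascal:
  assumes n: "\<And>i. n \<le> i \<Longrightarrow> (of_int l gchoose i :: complex) = 0 \<or> f (p + int i) (q - int i) = 0"
    "\<And>i. n \<le> i \<Longrightarrow> (of_int l gchoose i :: complex) = 0 \<or> f (p + 1 + int i) (q - 1 - int i) = 0"
  shows "binomial_sum s f (l + 1) p q =
    binomial_sum s f l p q + scale s (binomial_sum s f l (p + 1) (q - 1))"
proof -
  let ?c = "\<lambda>l i. of_int l gchoose i :: complex"
  let ?f = "\<lambda>i. f (p + int i) (q - int i)"
  have shift: "f (p + 1 + int i) (q - 1 - int i) = ?f (Suc i)" for i
    by (simp add: algebra_simps)
  have pascal: "?c (l + 1) (Suc i) = ?c l i + ?c l (Suc i)" for i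
    by (simp add: gbinomial_Suc_Suc)
  have split: "scale (s ^ Suc i * (x + y)) z = scale (s ^ Suc i * y) z + scale s (scale (s ^ i * x) z)"
    for i x y z
    by (simp add: distrib_left scale_left_distrib mult.assoc add.commute)
  have vanish: "scale (s ^ i * ?c (l + 1) i) (?f i) = 0" if i: "Suc n \<le> i" for i
  proof -
    obtain j where j: "i = Suc j" "n \<le> j" using i by (cases i) auto
    show ?thesis
      using n(1)[of i] n(2)[of j] j unfolding shift j(1) pascal by auto
  qed
  have "binomial_sum s f (l + 1) p q = (\<Sum>i<Suc n. scale (s ^ i * ?c (l + 1) i) (?f i))"
    unfolding binomial_sum_def by (rule Sum_any_eq_sum_lessThan) (rule vanish)
  also have "\<dots> = f p q + (\<Sum>i<n. scale (s ^ Suc i * ?c (l + 1) (Suc i)) (?f (Suc i)))"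
    by (simp only: sum.lessThan_Suc_shift) simp
  also have "\<dots> = (f p q + (\<Sum>i<n. scale (s ^ Suc i * ?c l (Suc i)) (?f (Suc i))))
      + scale s (\<Sum>i<n. scale (s ^ i * ?c l i) (?f (Suc i)))"
    unfolding pascal split scale_sum_right sum.distrib by (simp only: add.assoc)
  also have "f p q + (\<Sum>i<n. scale (s ^ Suc i * ?c l (Suc i)) (?f (Suc i)))
      = (\<Sum>i<Suc n. scale (s ^ i * ?c l i) (?f i))"
    by (simp only: sum.lessThan_Suc_shift) simp
  also have "\<dots> = binomial_sum s f l p q"
    unfolding binomial_sum_def
    by (rule Sum_any_eq_sum_lessThan[symmetric]) (use n(1) Suc_leD in fastforce)
  also have "(\<Sum>i<n. scale (s ^ i * ?c l i) (?f (Suc i))) = binomial_sum s f l (p + 1) (q - 1)"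
    unfolding binomial_sum_def shift
    by (rule Sum_any_eq_sum_lessThan[symmetric]) (use n(2) in \<open>auto simp: shift\<close>)
  finally show ?thesis .
qed

lemma binomial_sum_Pascal_truncated:
  assumes "\<And>p q. q < N \<Longrightarrow> f p q = 0"
  shows "binomial_sum s f (l + 1) p q =
    binomial_sum s f l p q + scale s (binomial_sum s f l (p + 1) (q - 1))"
  by (rule binomial_sum_Pascal[where n = "nat (q - N + 1)"]) (auto intro!: assms)

section \<open>The Jacobi identity as a recurrence\<close>

text \<open>
  The first summand of the Jacobi identity. The second one, including its minus sign, arises from
  it by exchanging \<open>(u,x\<^sub>1)\<close> with \<open>(v,x\<^sub>2)\<close> and replacing \<open>x\<^sub>0\<close> by \<open>-x\<^sub>0\<close>, since
  \<open>x\<^sub>0\<^sup>-\<^sup>1 \<delta>((-x\<^sub>2 + x\<^sub>1)/x\<^sub>0) = -(-x\<^sub>0)\<^sup>-\<^sup>1 \<delta>((x\<^sub>2 - x\<^sub>1)/(-x\<^sub>0))\<close>.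
\<close>

definition product_term :: "'v \<Rightarrow> 'v \<Rightarrow> 'v \<Rightarrow> int \<Rightarrow> int \<Rightarrow> int \<Rightarrow> 'v"
  where "product_term u v w a b c =
    binomial_sum (-1) (\<lambda>p q. Y u p (Y v q w)) (- a - 1) (a + b + 1) c"

definition iterate_term :: "'v \<Rightarrow> 'v \<Rightarrow> 'v \<Rightarrow> int \<Rightarrow> int \<Rightarrow> int \<Rightarrow> 'v"
  where "iterate_term u v w a b c =
    binomial_sum 1 (\<lambda>p q. Y (Y u q v) p w) (- b - 1) (b + c + 1) a"

definition jacobi_defect :: "'v \<Rightarrow> 'v \<Rightarrow> 'v \<Rightarrow> int \<Rightarrow> int \<Rightarrow> int \<Rightarrow> 'v"
  where "jacobi_defect u v w a b c =
    product_term u v w a b c + scale ((-1) powi a) (product_term v u w a c b)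
      - iterate_term u v w a b c"

lemma product_term_truncated: "\<exists>N. \<forall>a b c. c < N \<longrightarrow> product_term u v w a b c = 0"
proof -
  obtain N where "\<forall>n<N. Y v n w = 0" using Y_truncation by blast
  then show ?thesis
    unfolding product_term_def by (intro exI[of _ N]) (auto intro!: binomial_sum_eq_0_lower)
qed

lemma iterate_term_truncated: "\<exists>N. \<forall>a b c. a < N \<longrightarrow> iterate_term u v w a b c = 0"
proof -
  obtain N where "\<forall>n<N. Y u n v = 0" using Y_truncation by blast
  then show ?thesis
    unfolding iterate_term_def by (intro exI[of _ N]) (auto intro!: binomial_sum_eq_0_lower)
qed

text \<open>
  Both recurrences say that the term is annihilated by \<open>x\<^sub>0 - x\<^sub>1 + x\<^sub>2\<close>; in coefficients this is
  Pascal's rule.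
\<close>

lemma product_term_recurrence:
  "product_term u v w (a - 1) b c = product_term u v w a (b - 1) c - product_term u v w a b (c - 1)"
proof -
  obtain N where "\<forall>n<N. Y v n w = 0" using Y_truncation by blast
  then show ?thesis
    unfolding product_term_def
    using binomial_sum_Pascal_truncated[where s = "-1" and N = N and l = "- a - 1" and p = "a + b"
        and q = c and f = "\<lambda>p q. Y u p (Y v q w)"]
    by (simp add: algebra_simps)
qed

lemma iterate_term_recurrence:
  "iterate_term u v w (a - 1) b c = iterate_term u v w a (b - 1) c - iterate_term u v w a b (c - 1)"
proof -
  obtain N where "\<forall>n<N. Y u n v = 0" using Y_truncation by blast
  then show ?thesis
    unfolding iterate_term_def
    using binomial_sum_Pascal_truncated[where s = 1 and N = N and l = "- b - 1" and p = "b + c"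
        and q = a and f = "\<lambda>p q. Y (Y u q v) p w"]
    by (simp add: algebra_simps)
qed

lemma jacobi_defect_recurrence:
  "jacobi_defect u v w (a - 1) b c =
    jacobi_defect u v w a (b - 1) c - jacobi_defect u v w a b (c - 1)"
  unfolding jacobi_defect_def product_term_recurrence[of _ _ _ a] iterate_term_recurrence[of _ _ _ a]
    minus_one_powi_simps(1)
  by (simp add: scale_right_diff_distrib)

text \<open>
  In each of the following three convolutions the vector-valued factor fixes one exponent of the
  summation index, the delta function fixes the sum of the exponents, and the remaining freedom is
  the nonnegative exponent \<open>i\<close> of the variable in which the delta function is expanded.
\<close>

lemma jacobi_first_term:
  "((scale \<circ> (\<lambda>(a, b, c). delta_quot 1 (-1) a b c))
      \<odot> (\<lambda>(a, b, c). if a = 0 then Y u b (Y v c w) else 0)) (a, b, c) = product_term u v w a b c"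
proof -
  let ?h = "\<lambda>i::nat. (a, - a - 1 - int i, int i)"
  have outside: "d2 < 0 \<or> d0 \<noteq> a \<or> d1 + d2 \<noteq> - d0 - 1" if "(d0, d1, d2) \<notin> range ?h" for d0 d1 d2
    using that by (auto simp: image_iff dest!: spec[of _ "nat d2"])
  have "inj ?h" by (auto simp: inj_def)
  then show ?thesis
    unfolding fs_mult_def product_term_def binomial_sum_def
    apply (subst Sum_any_inj_reindex[where h = ?h])
      apply assumption
    subgoal for d
      using outside[of "fst d" "fst (snd d)" "snd (snd d)"]
      by (cases d) (auto simp: delta_quot_def binomial_series_def)
    by (simp add: delta_quot_def delta_def binomial_series_def algebra_simps)
qed

lemma jacobi_second_term:
  "((scale \<circ> (\<lambda>(a, b, c). delta_quot (-1) 1 a c b))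
      \<odot> (\<lambda>(a, b, c). if a = 0 then Y v c (Y u b w) else 0)) (a, b, c)
    = - scale ((-1) powi a) (product_term v u w a c b)"
proof -
  let ?h = "\<lambda>i::nat. (a, int i, - a - 1 - int i)"
  have outside: "d1 < 0 \<or> d0 \<noteq> a \<or> d1 + d2 \<noteq> - d0 - 1" if "(d0, d1, d2) \<notin> range ?h" for d0 d1 d2
    using that by (auto simp: image_iff dest!: spec[of _ "nat d1"])
  have sign: "(-1::complex) powi (- a - (1 + int i)) = - ((-1) powi a * (-1) ^ i)" for i
    using power_int_add[of "-1 :: complex" "- a - 1" "- int i"]
    by (simp add: minus_one_powi_simps algebra_simps)
  have rhs: "- scale ((-1) powi a) (product_term v u w a c b) = Sum_any (\<lambda>i. scale
      (- ((-1) powi a * (-1) ^ i) * (of_int (- a - 1) gchoose i))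
      (Y v (a + c + 1 + int i) (Y u (b - int i) w)))"
  proof -
    have "- scale x (Sum_any g) = Sum_any (\<lambda>i. scale (- x) (g i))" for x and g :: "nat \<Rightarrow> 'v"
      by (metis scale_Sum_any scale_minus_left)
    then show ?thesis
      unfolding product_term_def binomial_sum_def by (simp add: mult.assoc)
  qed
  have "inj ?h" by (auto simp: inj_def)
  then show ?thesis
    unfolding fs_mult_def rhs
    apply (subst Sum_any_inj_reindex[where h = ?h])
      apply assumption
    subgoal for d
      using outside[of "fst d" "fst (snd d)" "snd (snd d)"]
      by (cases d) (auto simp: delta_quot_def binomial_series_def)
    by (simp add: delta_quot_def delta_def binomial_series_def sign algebra_simps)
qed

lemma jacobi_third_term:
  "((scale \<circ> (\<lambda>(a, b, c). delta_quot 1 1 b c a))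
      \<odot> (\<lambda>(a, b, c). if b = 0 then Y (Y u a v) c w else 0)) (a, b, c) = iterate_term u v w a b c"
proof -
  let ?h = "\<lambda>i::nat. (int i, b, - b - 1 - int i)"
  have outside: "d0 < 0 \<or> d1 \<noteq> b \<or> d0 + d2 \<noteq> - d1 - 1" if "(d0, d1, d2) \<notin> range ?h" for d0 d1 d2
    using that by (auto simp: image_iff dest!: spec[of _ "nat d0"])
  have "inj ?h" by (auto simp: inj_def)
  then show ?thesis
    unfolding fs_mult_def iterate_term_def binomial_sum_def
    apply (subst Sum_any_inj_reindex[where h = ?h])
      apply assumption
    subgoal for d
      using outside[of "fst d" "fst (snd d)" "snd (snd d)"]
      by (cases d) (auto simp: delta_quot_def binomial_series_def)
    by (simp add: delta_quot_def delta_def binomial_series_def algebra_simps)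
qed

lemma jacobi_identity_iff: "jacobi_identity scale Y \<longleftrightarrow> (\<forall>u v w a b c. jacobi_defect u v w a b c = 0)"
  unfolding jacobi_identity_def split_paired_All jacobi_first_term jacobi_second_term
    jacobi_third_term jacobi_defect_def
  by simp

section \<open>Weak skew-associativity as vanishing for low powers of \<open>x\<^sub>2\<close>\<close>

text \<open>
  The part of the Jacobi defect that survives a residue in \<open>x\<^sub>2\<close> against a high power of \<open>x\<^sub>2\<close>.
  At \<open>c = - k - 1\<close> with \<open>k \<ge> 0\<close> it consists of the coefficients of \<open>(x\<^sub>1 - x\<^sub>0)\<^sup>k\<close> times the difference
  compared in weak skew-associativity.
\<close>

definition skew_defect :: "'v \<Rightarrow> 'v \<Rightarrow> 'v \<Rightarrow> int \<Rightarrow> int \<Rightarrow> int \<Rightarrow> 'v"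
  where "skew_defect u v w a b c =
    scale ((-1) powi a) (product_term v u w a c b) - iterate_term u v w a b c"

lemma jacobi_defect_eq: "jacobi_defect u v w a b c = product_term u v w a b c + skew_defect u v w a b c"
  by (simp add: jacobi_defect_def skew_defect_def)

lemma skew_defect_recurrence:
  "skew_defect u v w a b (c - 1) = skew_defect u v w a (b - 1) c - skew_defect u v w (a - 1) b c"
  unfolding skew_defect_def product_term_recurrence[of _ _ _ a] iterate_term_recurrence[of _ _ _ a]
    minus_one_powi_simps(1)
  by (simp add: scale_right_diff_distrib)

text \<open>
  The two sides of weak skew-associativity are the terms of the Jacobi identity at
  \<open>x\<^sub>2\<^sup>-\<^sup>1\<close>. The substitutions carry the binomial coefficients \<open>a + i\<close> over \<open>i\<close>, the delta
  functions \<open>- a - 1\<close> over \<open>i\<close> (and likewise with \<open>b\<close>); negation of the upper index turns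
  one into the other.
\<close>

lemma skew_associativity_left_side:
  "((\<lambda>(a, b) z. subst_binomial scale (-1) 1 (\<lambda>n. Y v n z) a b)
      \<odot> (\<lambda>(a, b). if a = 0 then Y u b w else 0)) (a, b)
    = scale ((-1) powi a) (product_term v u w a (-1) b)"
proof -
  let ?h = "\<lambda>i::nat. (a, int i)"
  have outside: "d1 < 0 \<or> d0 \<noteq> a" if "(d0, d1) \<notin> range ?h" for d0 d1
    using that by (auto simp: image_iff dest!: spec[of _ "nat d1"])
  have upper: "(of_int (- a - 1) gchoose i :: complex) =
      (-1) ^ i * (of_int (a + int i) gchoose i)" for i
    by (subst gbinomial_negated_upper) (simp add: algebra_simps)
  have "inj ?h" by (auto simp: inj_def)
  then show ?thesis
    unfolding fs_mult_def product_term_def binomial_sum_def scale_Sum_any upper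
    apply (subst Sum_any_inj_reindex[where h = ?h])
      apply assumption
    subgoal for d
      using outside[of "fst d" "snd d"]
      by (cases d) (auto simp: subst_binomial_def binomial_series_def)
    by (simp add: subst_binomial_def binomial_series_def mult.assoc[symmetric] power_mult_distrib[symmetric] mult.commute)
qed

lemma skew_associativity_right_side:
  "((\<lambda>(a, b) z. subst_binomial scale 1 (-1) (\<lambda>n. Y z n w) b a)
      \<odot> (\<lambda>(a, b). if b = 0 then Y u a v else 0)) (a, b)
    = iterate_term u v w a b (-1)"
proof -
  let ?h = "\<lambda>i::nat. (int i, b)"
  have outside: "d0 < 0 \<or> d1 \<noteq> b" if "(d0, d1) \<notin> range ?h" for d0 d1
    using that by (auto simp: image_iff dest!: spec[of _ "nat d0"])
  have upper: "(of_int (- b - 1) gchoose i :: complex) =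
      (-1) ^ i * (of_int (b + int i) gchoose i)" for i
    by (subst gbinomial_negated_upper) (simp add: algebra_simps)
  have "inj ?h" by (auto simp: inj_def)
  then show ?thesis
    unfolding fs_mult_def iterate_term_def binomial_sum_def upper
    apply (subst Sum_any_inj_reindex[where h = ?h])
      apply assumption
    subgoal for d
      using outside[of "fst d" "snd d"]
      by (cases d) (auto simp: subst_binomial_def binomial_series_def)
    by (simp add: subst_binomial_def binomial_series_def mult.commute)
qed

lemma binomial_power_mult:
  "((scale \<circ> (\<lambda>(a, b). binomial_series 1 (-1) (int m) b a)) \<odot> F) (a, b)
    = binomial_sum (-1) (\<lambda>p q. F (q, p)) (int m) (b - int m) a"
proof -
  let ?h = "\<lambda>i::nat. (int i, int m - int i)"
  have outside: "d0 < 0 \<or> d1 + d0 \<noteq> int m" if "(d0, d1) \<notin> range ?h" for d0 d1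
    using that by (auto simp: image_iff dest!: spec[of _ "nat d0"])
  have "inj ?h" by (auto simp: inj_def)
  then show ?thesis
    unfolding fs_mult_def binomial_sum_def
    apply (subst Sum_any_inj_reindex[where h = ?h])
      apply assumption
    subgoal for d
      using outside[of "fst d" "snd d"]
      by (cases d) (auto simp: binomial_series_def)
    by (simp add: binomial_series_def algebra_simps)
qed

text \<open>
  The hypothesis says that passing from \<open>c\<close> to \<open>c - 1\<close> multiplies the series
  \<open>G _ _ c\<close> in \<open>x\<^sub>0, x\<^sub>1\<close> by \<open>x\<^sub>1 - x\<^sub>0\<close>; hence passing to \<open>c - m\<close> multiplies it by
  \<open>(x\<^sub>1 - x\<^sub>0)\<^sup>m\<close>.
\<close>

lemma binomial_sum_iterated_difference:
  assumes "\<And>a b c. G a b (c - 1) = G a (b - 1) c - G (a - 1) b c"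
  shows "binomial_sum (-1) (\<lambda>p q. G q p c) (int m) (b - int m) a = G a b (c - int m)"
proof (induction m arbitrary: a b)
  case 0
  then show ?case by simp
next
  case (Suc m)
  have vanish: "(of_int (int m) gchoose i :: complex) = 0" if "Suc m \<le> i" for i
    using that by (simp add: binomial_gbinomial[symmetric])
  have "binomial_sum (-1) (\<lambda>p q. G q p c) (int m + 1) (b - 1 - int m) a =
      G a (b - 1) (c - int m) - G (a - 1) b (c - int m)"
    using Suc.IH[where a = a and b = "b - 1"] Suc.IH[where a = "a - 1" and b = b]
    by (subst binomial_sum_Pascal[where n = "Suc m"])
      (auto simp del: of_int_of_nat_eq simp: vanish algebra_simps)
  moreover have "int (Suc m) = int m + 1" "b - (int m + 1) = b - 1 - int m"
    "c - (int m + 1) = c - int m - 1"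
    by simp_all
  ultimately show ?case
    by (simp only: assms[of a b "c - int m"])
qed

lemma weak_skew_associativity_iff:
  "weak_skew_associativity scale Y \<longleftrightarrow>
    (\<forall>u v w. \<exists>m::nat. \<forall>a b. skew_defect u v w a b (- 1 - int m) = 0)"
  unfolding weak_skew_associativity_def split_paired_All binomial_power_mult
    skew_associativity_left_side skew_associativity_right_side skew_defect_def[symmetric]
    binomial_sum_iterated_difference[of "skew_defect _ _ _", OF skew_defect_recurrence]
  by (rule refl)

text \<open>
  Vanishing of the skew defect at one exponent of \<open>x\<^sub>2\<close> passes to all lower ones by the
  recurrence, and for low exponents of \<open>x\<^sub>2\<close> the term \<open>Y(u,x\<^sub>1)Y(v,x\<^sub>2)w\<close> does not
  contribute, so that the skew defect is the whole Jacobi defect.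
\<close>

lemma weak_skew_associativity_iff_truncated:
  "weak_skew_associativity scale Y \<longleftrightarrow>
    (\<forall>u v w. \<exists>C. \<forall>a b c. c < C \<longrightarrow> jacobi_defect u v w a b c = 0)"
  unfolding weak_skew_associativity_iff
proof (intro all_cong1 iffI)
  fix u v w
  obtain N where N: "\<And>a b c. c < N \<Longrightarrow> product_term u v w a b c = 0"
    using product_term_truncated by blast
  {
    assume "\<exists>m::nat. \<forall>a b. skew_defect u v w a b (- 1 - int m) = 0"
    then obtain m where m: "\<And>a b. skew_defect u v w a b (- 1 - int m) = 0" by blast
    have "skew_defect u v w a b (- 1 - int m - int k) = 0" for a b k
    proof (induction k arbitrary: a b)
      case (Suc k)
      then show ?case
        using skew_defect_recurrence[of u v w a b "- 1 - int m - int k"] by (simp add: algebra_simps)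
    qed (simp add: m)
    then have "skew_defect u v w a b c = 0" if "c < - int m" for a b c
    proof -
      have "c = - 1 - int m - int (nat (- 1 - int m - c))" using that by simp
      then show ?thesis using \<open>\<And>a b k. skew_defect u v w a b (- 1 - int m - int k) = 0\<close> by metis
    qed
    then show "\<exists>C. \<forall>a b c. c < C \<longrightarrow> jacobi_defect u v w a b c = 0"
      using N by (intro exI[of _ "min N (- int m)"]) (simp add: jacobi_defect_eq)
  next
    assume "\<exists>C. \<forall>a b c. c < C \<longrightarrow> jacobi_defect u v w a b c = 0"
    then obtain C where C: "\<And>a b c. c < C \<Longrightarrow> jacobi_defect u v w a b c = 0" by blast
    \<comment> \<open>The exponent \<open>- 1 - m\<close> has to lie below both \<open>N\<close> and \<open>C\<close>.\<close>
    define m where "m = nat (- min N C)"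
    have "- 1 - int m < N" "- 1 - int m < C" by (auto simp: m_def)
    then have "skew_defect u v w a b (- 1 - int m) = 0" for a b
      using C[of "- 1 - int m" a b] N[of "- 1 - int m" a b] by (simp add: jacobi_defect_eq)
    then show "\<exists>m::nat. \<forall>a b. skew_defect u v w a b (- 1 - int m) = 0" by blast
  }
qed

section \<open>Consequences of the vacuum axioms\<close>

text \<open>
  The recurrence with the exponent of \<open>x\<^sub>1\<close> as free parameter expresses the coefficients at
  \<open>(a, c)\<close> by those at \<open>(a - 1, c)\<close> and \<open>(a, c - 1)\<close>. If \<open>a\<close> and \<open>c\<close> are negative, every term
  vanishes: \<open>Y(z,x\<^sub>0)\<one>\<close> has no negative powers, and \<open>Y(\<one>,x\<^sub>2)\<close> is constant while
  \<open>(x\<^sub>1 - x\<^sub>2)\<^sup>-\<^sup>a\<^sup>-\<^sup>1\<close> is a polynomial.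
\<close>

lemma jacobi_defect_vac_middle:
  assumes "weak_skew_associativity scale Y" and "c < 0"
  shows "jacobi_defect z vac w a b c = 0"
proof -
  obtain C where C: "\<And>a b c. c < C \<Longrightarrow> jacobi_defect z vac w a b c = 0"
    using assms(1) unfolding weak_skew_associativity_iff_truncated by blast
  have left: "jacobi_defect z vac w a b c = 0" if "a < 0" "c < 0" for a b c
  proof -
    have 1: "product_term z vac w a b c = 0"
      unfolding product_term_def using \<open>c < 0\<close> by (intro binomial_sum_eq_0_lower) (auto simp: Y_vac)
    have 2: "product_term vac z w a c b = 0"
      unfolding product_term_def using that by (intro binomial_sum_eq_0_upper) (auto simp: Y_vac)
    have 3: "iterate_term z vac w a b c = 0"
      unfolding iterate_term_def using \<open>a < 0\<close> by (intro binomial_sum_eq_0_lower) (auto simp: Y_creation)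
    show ?thesis by (simp add: jacobi_defect_def 1 2 3)
  qed
  have "\<forall>b. jacobi_defect z vac w a b c = 0"
  proof (rule quadrant_induct[where V = "\<lambda>a c. \<forall>b. jacobi_defect z vac w a b c = 0"
        and C = C and A = 0 and K = 0])
    fix a c
    assume "\<forall>b. jacobi_defect z vac w (a - 1) b c = 0" "\<forall>b. jacobi_defect z vac w a b (c - 1) = 0"
    then show "\<forall>b. jacobi_defect z vac w a b c = 0"
      using jacobi_defect_recurrence[of z vac w a "b + 1" c for b] by simp
  qed (use C left assms(2) in auto)
  then show ?thesis by blast
qed

text \<open>
  The same argument with the exponents \<open>b\<close> of \<open>x\<^sub>1\<close> and \<open>c\<close> of \<open>x\<^sub>2\<close>. Applied to the
  vacuum, the first product has no negative powers of \<open>x\<^sub>2\<close> and the second none of \<open>x\<^sub>1\<close>;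
  for \<open>b < 0\<close> the third term contains the polynomial \<open>(x\<^sub>2 + x\<^sub>0)\<^sup>-\<^sup>b\<^sup>-\<^sup>1\<close>, hence no
  negative powers of \<open>x\<^sub>2\<close>.
\<close>

lemma jacobi_defect_vac_right:
  assumes "weak_skew_associativity scale Y" and "c < 0"
  shows "jacobi_defect u v vac a b c = 0"
proof -
  obtain C where C: "\<And>a b c. c < C \<Longrightarrow> jacobi_defect u v vac a b c = 0"
    using assms(1) unfolding weak_skew_associativity_iff_truncated by blast
  have left: "jacobi_defect u v vac a b c = 0" if "b < 0" "c < 0" for a b c
  proof -
    have 1: "product_term u v vac a b c = 0" "product_term v u vac a c b = 0"
      unfolding product_term_def using that by (auto intro!: binomial_sum_eq_0_lower simp: Y_creation)
    have 2: "iterate_term u v vac a b c = 0"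
      unfolding iterate_term_def using that by (intro binomial_sum_eq_0_upper) (auto simp: Y_creation)
    show ?thesis by (simp add: jacobi_defect_def 1 2)
  qed
  have "\<forall>a. jacobi_defect u v vac a b c = 0"
  proof (rule quadrant_induct[where V = "\<lambda>b c. \<forall>a. jacobi_defect u v vac a b c = 0"
        and C = C and A = 0 and K = 0])
    fix b c
    assume "\<forall>a. jacobi_defect u v vac a (b - 1) c = 0" "\<forall>a. jacobi_defect u v vac a b (c - 1) = 0"
    then have "jacobi_defect u v vac (a + 1 - 1) b c = 0" for a
      by (subst jacobi_defect_recurrence) simp
    then show "\<forall>a. jacobi_defect u v vac a b c = 0" by simp
  qed (use C left assms(2) in auto)
  then show ?thesis by blast
qed

lemma vderiv_eq: "vderiv Y vac z = Y z 1 vac"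
  by (simp add: vderiv_def vmode_def)

lemma binomial_sum_two_terms:
  assumes "\<And>p' q'. q' < q - 1 \<Longrightarrow> f p' q' = 0"
  shows "binomial_sum s f l p q = f p q + scale (s * of_int l) (f (p + 1) (q - 1))"
  unfolding binomial_sum_def
  by (subst Sum_any_eq_sum_lessThan[of 2]) (auto simp: assms numeral_2_eq_2)

text \<open>
  The coefficient of \<open>x\<^sub>0 x\<^sub>1\<^sup>n x\<^sub>2\<^sup>-\<^sup>1\<close> in the Jacobi identity for \<open>(z, \<one>, w)\<close>. There both
  products vanish, and creation leaves only two terms of the iterate.
\<close>

lemma Y_vderiv:
  assumes "weak_skew_associativity scale Y"
  shows "Y (vderiv Y vac z) n w = scale (of_int (n + 1)) (Y z (n + 1) w)"
proof -
  have 1: "product_term z vac w 1 n (-1) = 0"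
    unfolding product_term_def by (intro binomial_sum_eq_0_lower) (auto simp: Y_vac)
  have 2: "product_term vac z w 1 (-1) n = 0"
    unfolding product_term_def binomial_sum_def by (simp add: Y_vac)
  have "iterate_term z vac w 1 n (-1) = Y (Y z 1 vac) n w + scale (of_int (- n - 1)) (Y z (n + 1) w)"
    unfolding iterate_term_def
    by (subst binomial_sum_two_terms) (auto simp: Y_creation Y_creation_0)
  then show ?thesis
    using jacobi_defect_vac_middle[OF assms, of "-1" z w 1 n]
    by (simp add: jacobi_defect_def 1 2 vderiv_eq scale_left_diff_distrib scale_left_distrib
        eq_neg_iff_add_eq_0 algebra_simps)
qed

text \<open>This is Taylor's formula for \<open>Y(e\<^sup>x\<^sup>\<D> z, y) = Y(z, y + x)\<close>, coefficient by coefficient.\<close>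

lemma Y_vderiv_power:
  assumes "weak_skew_associativity scale Y"
  shows "Y ((vderiv Y vac ^^ i) z) n w =
    scale (fact i * (of_int (n + int i) gchoose i)) (Y z (n + int i) w)"
proof (induction i arbitrary: n)
  case (Suc i)
  have "(of_int (n + 1) :: complex) * (fact i * (of_int (n + 1 + int i) gchoose i))
      = fact (Suc i) * (of_int (n + int (Suc i)) gchoose Suc i)"
  proof -
    let ?x = "of_int (n + 1 + int i) :: complex"
    have "of_nat (Suc i) * (?x gchoose Suc i) = (?x - of_nat i) * (?x gchoose i)"
      by (simp only: gbinomial_absorb_comp gbinomial_absorption)
    from arg_cong[OF this, of "(*) (fact i)"] show ?thesis by (simp add: algebra_simps)
  qed
  then show ?case
    by (simp add: Y_vderiv[OF assms] Suc.IH algebra_simps)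
qed simp

lemma exp_series_vderiv:
  assumes "weak_skew_associativity scale Y"
  shows "exp_series scale (vderiv Y vac) n z = Y z n vac"
proof (cases "0 \<le> n")
  case True
  then obtain i where n: "n = int i" by (metis nonneg_int_cases)
  have "(vderiv Y vac ^^ i) z = scale (fact i) (Y z (int i) vac)"
    using Y_vderiv_power[OF assms, of i z 0 vac]
    by (simp add: Y_creation_0 binomial_gbinomial[symmetric])
  then show ?thesis by (simp add: exp_series_def n)
qed (simp add: exp_series_def Y_creation)

lemma Y_creation_iterated:
  assumes "weak_skew_associativity scale Y"
  shows "Y (Y z (int i) vac) n w = scale (of_int (n + int i) gchoose i) (Y z (n + int i) w)"
  unfolding exp_series_vderiv[OF assms, symmetric]
  by (simp add: exp_series_def Y_scale_left Y_vderiv_power[OF assms])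

text \<open>
  The coefficient of \<open>x\<^sub>0\<^sup>n x\<^sub>1\<^sup>0 x\<^sub>2\<^sup>-\<^sup>1\<close> in the Jacobi identity for \<open>(v, u, \<one>)\<close>. Since
  \<open>Y(z,x)\<one> = e\<^sup>x\<^sup>\<D>z\<close>, this is skew-symmetry with \<open>\<D>\<close> eliminated.
\<close>

lemma Y_swap_arguments:
  assumes "weak_skew_associativity scale Y"
  shows "Y u n v =
    scale ((-1) powi n) (Sum_any (\<lambda>i. scale ((-1) ^ i) (Y (Y v (n - int i) u) (int i) vac)))"
proof -
  have 1: "product_term v u vac n 0 (-1) = 0"
    unfolding product_term_def by (intro binomial_sum_eq_0_lower) (auto simp: Y_creation)
  have 2: "product_term u v vac n (-1) 0 = Y u n v"
    unfolding product_term_def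
    by (subst binomial_sum_two_terms) (auto simp: Y_creation Y_creation_0)
  have 3: "iterate_term v u vac n 0 (-1) =
      Sum_any (\<lambda>i. scale ((-1) ^ i) (Y (Y v (n - int i) u) (int i) vac))"
    unfolding iterate_term_def binomial_sum_def by (simp add: gbinomial_minus_one)
  have "scale ((-1) powi n) (Y u n v) = iterate_term v u vac n 0 (-1)"
    using jacobi_defect_vac_right[OF assms, of "-1" v u n 0] by (simp add: jacobi_defect_def 1 2)
  then show ?thesis
    unfolding 3[symmetric] by (metis minus_one_powi_simps(3) scale_one scale_scale)
qed

lemma weak_skew_associativity_imp_skew_symmetry:
  assumes "weak_skew_associativity scale Y"
  shows "skew_symmetry scale Y vac"
  unfolding skew_symmetry_def
proof (intro allI)
  fix u v n
  have sign: "(-1::complex) powi (n - int i) = (-1) powi n * (-1) ^ i" for i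
    using power_int_add[of "-1 :: complex" n "- int i"] by (simp add: minus_one_powi_simps)
  have "(exp_series scale (vderiv Y vac) \<odot> (\<lambda>k. scale ((-1) powi k) (Y v k u))) n
      = Sum_any (\<lambda>i::nat. scale ((-1) powi (n - int i)) (Y (Y v (n - int i) u) (int i) vac))"
    unfolding fs_mult_def exp_series_vderiv[OF assms] Y_scale_left
    by (rule Sum_any_inj_reindex) (auto intro!: Y_creation simp: image_iff, metis nonneg_int_cases not_le)
  also have "\<dots> = Y u n v"
    by (subst Y_swap_arguments[OF assms]) (simp add: sign scale_Sum_any)
  finally show "Y u n v =
    (exp_series scale (vderiv Y vac) \<odot> (\<lambda>k. scale ((-1) powi k) (Y v k u))) n" ..
qed

section \<open>Exchange symmetry and the Jacobi identity\<close>

text \<open>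
  The third term depends on \<open>u\<close> and \<open>v\<close> through \<open>Y(u,x\<^sub>0)v\<close> only, and skew-symmetry together with
  \<open>Y(e\<^sup>x\<^sup>\<D> z, y) = Y(z, y + x)\<close> turns it into the third term for \<open>(v, u)\<close>. In coefficients this
  is seen directly at \<open>b = -1\<close>. For other \<open>b\<close> use induction on \<open>a\<close>: both sides satisfy
  the same recurrence, so once they agree at \<open>a - 1\<close>, their difference at \<open>a\<close> depends on
  \<open>b + c\<close> alone.
\<close>

lemma iterate_term_swap:
  assumes "weak_skew_associativity scale Y"
  shows "iterate_term u v w a b c = scale ((-1) powi a) (iterate_term v u w a c b)"
proof -
  define g where "g a b c =
    iterate_term u v w a b c - scale ((-1) powi a) (iterate_term v u w a c b)" for a b c
  have base: "g a (-1) c = 0" for a c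
  proof -
    obtain N where N: "\<forall>n<N. Y v n u = 0" using Y_truncation by blast
    have upper: "(of_int (- c - 1) gchoose i :: complex) =
      (-1) ^ i * (of_int (c + int i) gchoose i)" for i
      by (subst gbinomial_negated_upper) (simp add: algebra_simps)
    have "iterate_term u v w a (-1) c = Y (Y u a v) c w"
      by (simp add: iterate_term_def)
    also have "\<dots> = scale ((-1) powi a)
        (Sum_any (\<lambda>i. scale ((-1) ^ i) (Y (Y (Y v (a - int i) u) (int i) vac) c w)))"
      by (subst Y_swap_arguments[OF assms], unfold Y_scale_left, subst Y_Sum_any_left[where k = "nat (a - N + 1)"])
        (use N in \<open>auto simp: Y_scale_left\<close>)
    also have "\<dots> = scale ((-1) powi a) (iterate_term v u w a c (-1))"
      unfolding iterate_term_def binomial_sum_def upper Y_creation_iterated[OF assms] by simp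
    finally show ?thesis by (simp add: g_def)
  qed
  have rec: "g (a - 1) b c = g a (b - 1) c - g a b (c - 1)" for a b c
    unfolding g_def iterate_term_recurrence[of _ _ _ a] minus_one_powi_simps(1)
    by (simp add: scale_right_diff_distrib)
  obtain N1 N2 where N: "\<And>a b c. a < N1 \<Longrightarrow> iterate_term u v w a b c = 0"
    "\<And>a b c. a < N2 \<Longrightarrow> iterate_term v u w a b c = 0"
    using iterate_term_truncated by metis
  have "\<forall>b c. g a b c = 0"
  proof (induction "nat (a - min N1 N2 + 1)" arbitrary: a rule: less_induct)
    case less
    show ?case
    proof (cases "a < min N1 N2")
      case True
      then show ?thesis using N by (simp add: g_def)
    next
      case False
      then have "g (a - 1) b c = 0" for b c using less by auto
      then have "g a (b - 1) c = g a b (c - 1)" for b c using rec[of a b c] by simp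
      then show ?thesis
        using int_shift_invariant[of "g a" _ _ "-1"] base by metis
    qed
  qed
  then show ?thesis by (simp add: g_def)
qed

lemma jacobi_defect_swap:
  assumes "weak_skew_associativity scale Y"
  shows "jacobi_defect u v w a b c = scale ((-1) powi a) (jacobi_defect v u w a c b)"
  unfolding jacobi_defect_def iterate_term_swap[OF assms, of u v]
  by (simp add: scale_right_diff_distrib scale_right_distrib minus_one_powi_simps(3))

lemma weak_skew_associativity_imp_jacobi:
  assumes "weak_skew_associativity scale Y"
  shows "jacobi_identity scale Y"
  unfolding jacobi_identity_iff
proof (intro allI)
  fix u v w a b c
  obtain B C where C: "\<And>a b c. c < C \<Longrightarrow> jacobi_defect u v w a b c = 0"
    and B: "\<And>a b c. c < B \<Longrightarrow> jacobi_defect v u w a b c = 0"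
    using assms unfolding weak_skew_associativity_iff_truncated by metis
  have B': "jacobi_defect u v w a b c = 0" if "b < B" for a b c
    by (subst jacobi_defect_swap[OF assms]) (simp add: B that)
  have "\<forall>a. jacobi_defect u v w a b c = 0"
  proof (rule quadrant_induct[where V = "\<lambda>b c. \<forall>a. jacobi_defect u v w a b c = 0"
        and C = C and A = B and K = "c + 1"])
    fix b c
    assume "\<forall>a. jacobi_defect u v w a (b - 1) c = 0" "\<forall>a. jacobi_defect u v w a b (c - 1) = 0"
    then have "jacobi_defect u v w (a + 1 - 1) b c = 0" for a
      by (subst jacobi_defect_recurrence) simp
    then show "\<forall>a. jacobi_defect u v w a b c = 0" by simp
  qed (use C B' in auto)
  then show "jacobi_defect u v w a b c = 0" by blast
qed

lemma jacobi_imp_weak_skew_associativity: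
  "jacobi_identity scale Y \<Longrightarrow> weak_skew_associativity scale Y"
  unfolding jacobi_identity_iff weak_skew_associativity_iff_truncated by blast

text \<open>
  The coefficient of \<open>x\<^sub>0\<^sup>n x\<^sub>1\<^sup>-\<^sup>1 x\<^sub>2\<close> in the Jacobi identity for \<open>(u, v, \<one>)\<close>, that is,
  the formula for the mode \<open>(u\<^sub>m v)\<^sub>-\<^sub>2 \<one>\<close> with \<open>m = - n - 1\<close>.
\<close>

lemma jacobi_imp_D_bracket_derivative:
  assumes "jacobi_identity scale Y"
  shows "D_bracket_derivative scale Y vac"
  unfolding D_bracket_derivative_def
proof (intro allI)
  fix u v n
  have 1: "product_term v u vac n 1 (-1) = 0"
    unfolding product_term_def by (intro binomial_sum_eq_0_lower) (auto simp: Y_creation)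
  have 2: "product_term u v vac n (-1) 1 =
      Y u n (vderiv Y vac v) + scale (of_int (n + 1)) (Y u (n + 1) v)"
    unfolding product_term_def vderiv_eq
    by (subst binomial_sum_two_terms) (auto simp: Y_creation Y_creation_0 algebra_simps)
  have 3: "iterate_term u v vac n (-1) 1 = vderiv Y vac (Y u n v)"
    by (simp add: iterate_term_def vderiv_eq)
  have "jacobi_defect u v vac n (-1) 1 = 0"
    using assms unfolding jacobi_identity_iff by blast
  then show "vderiv Y vac (Y u n v) - Y u n (vderiv Y vac v) = fs_deriv scale (\<lambda>k. Y u k v) n"
    by (simp add: jacobi_defect_def 1 2 3 fs_deriv_def algebra_simps)
qed

end

theorem proposition6p12:
  fixes scale :: "complex \<Rightarrow> 'v::ab_group_add \<Rightarrow> 'v"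
    and Y :: "'v \<Rightarrow> int \<Rightarrow> 'v \<Rightarrow> 'v" and vac :: 'v
  assumes "minor_vertex_axioms scale Y vac"
  shows "(jacobi_identity scale Y \<longleftrightarrow>
            weak_skew_associativity scale Y \<and> skew_symmetry scale Y vac) \<and>
         (jacobi_identity scale Y \<longleftrightarrow>
            weak_skew_associativity scale Y \<and> D_bracket_derivative scale Y vac)"
proof -
  interpret minor_vertex_axioms scale Y vac by fact
  show ?thesis
    using weak_skew_associativity_imp_jacobi weak_skew_associativity_imp_skew_symmetry
      jacobi_imp_weak_skew_associativity jacobi_imp_D_bracket_derivative
    by blast
qed

end
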